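(* For every positive integer $n$, each of the following statistics on $S_n$ is homomesic with respect to the complement map $\mathcal{C}$, while, for each of them, there is some $n$ for which it is not homomesic on $S_n$ with respect to the reverse map $\mathcal{R}$: (1) the number of inversions of the second entry, $\#\{j>2:\sigma_j<\sigma_2\}$; (2) the number of inversions of the third entry, $\#\{j>3:\sigma_j<\sigma_3\}$; (3) the major index; (4) the number of odd descents; (5) the number of even descents; (6) the rank; (7) the first entry $\sigma_1$; (8) the staircase size; (9) the Babson–Steingrímsson statistic $\mathrm{stat}$; (10) the last entry $\sigma_n$; (11) the number of steps on the non-negative side of the walk associated with $\sigma$; (12) $\mathrm{maj}(\sigma)-\mathrm{inv}(\sigma)$; (13) $\mathrm{inv}(\sigma)+\mathrm{maj}(\sigma)$.
   Context: Homomesy: given a finite set $S$, a bijection $\mathcal{X}:S\to S$ and $f:S\to\mathbb{Z}$, $f$ is homomesic if there is a constant $c$ such that for every orbit $\mathcal{O}$ of $\mathcal{X}$, $\frac{1}{|\mathcal{O}|}\sum_{x\in\mathcal{O}}f(x)=c$. For $\sigma\in S_n$ in one-line notation: $\mathcal{R}(\sigma)_i=\sigma_{n+1-i}$, $\mathcal{C}(\sigma)_i=n+1-\sigma_i$. $\mathrm{inv}(\sigma)$ is the number of pairs $i<j$ with $\sigma_i>\sigma_j$. A descent is $i\in[n-1]$ with $\sigma_i>\sigma_{i+1}$, otherwise an ascent; $\mathrm{maj}(\sigma)$ is the sum of the descents; odd (even) descents are descents $i$ with $i$ odd (even). The rank of $\sigma$ is its position ($1$ to $n!$) in lexicographic order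 on $S_n$. The Lehmer code is $L(\sigma)_i=\#\{j>i:\sigma_j<\sigma_i\}$; the staircase size is the largest $k$ for which there exist indices $i_k<i_{k-1}<\dots<i_1$ with $L(\sigma)_{i_j}\ge j$ for all $j$. An occurrence of the vincular pattern $ab\text{-}c$ is a triple of positions $i<i+1<k$ with $\sigma_i\sigma_{i+1}\sigma_k$ in the same relative order as $abc$; $\mathrm{stat}(\sigma)$ is the total number of occurrences of $13\text{-}2$, $21\text{-}3$, $32\text{-}1$ plus the number of descents. The walk associated with $\sigma$ starts at height $0$ and, for $i=1,\dots,n-1$, takes an up step if $i$ is an ascent and a down step if $i$ is a descent; the statistic counts the steps that begin and end at non-negative height. *)

theory Defs
  imports Complex_Main "HOL-Combinatorics.Combinatorics"
begin

text \<open>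
  For a bijection \<open>X\<close> of a finite set \<open>S\<close>, the orbits of \<open>X\<close> are the sets \<open>orbit X x\<close>
  (the points \<open>(X ^^ k) x\<close> with \<open>k > 0\<close>) for \<open>x \<in> S\<close>. The definition is meant for finite \<open>S\<close>
  and \<open>bij_betw X S S\<close>; the lemmas \<open>finite_Sym\<close>, \<open>bij_betw_reverse\<close> and
  \<open>bij_betw_complement\<close> discharge these conditions for the maps used here.
\<close>
definition homomesic :: "'a set \<Rightarrow> ('a \<Rightarrow> 'a) \<Rightarrow> ('a \<Rightarrow> int) \<Rightarrow> bool" where
  "homomesic S X f \<longleftrightarrow>
     (\<exists>c::real. \<forall>Orb \<in> orbit X ` S. 1 / real (card Orb) * (\<Sum>x\<in>Orb. real_of_int (f x)) = c)"

text \<open>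
  The one-line notation of \<open>\<sigma> \<in> Sym n\<close> is \<open>\<sigma> 1, \<dots>, \<sigma> n\<close>; outside \<open>{1..n}\<close> every
  element of \<open>Sym n\<close> is the identity.
\<close>
definition Sym :: "nat \<Rightarrow> (nat \<Rightarrow> nat) set" where
  "Sym n = {\<sigma>. \<sigma> permutes {1..n}}"

definition reverse_perm :: "nat \<Rightarrow> (nat \<Rightarrow> nat) \<Rightarrow> nat \<Rightarrow> nat" where
  "reverse_perm n \<sigma> = (\<lambda>i. if i \<in> {1..n} then \<sigma> (n + 1 - i) else i)"

definition complement_perm :: "nat \<Rightarrow> (nat \<Rightarrow> nat) \<Rightarrow> nat \<Rightarrow> nat" where
  "complement_perm n \<sigma> = (\<lambda>i. if i \<in> {1..n} then n + 1 - \<sigma> i else i)"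

definition inversions :: "nat \<Rightarrow> (nat \<Rightarrow> nat) \<Rightarrow> nat" where
  "inversions n \<sigma> = card {(i, j). 1 \<le> i \<and> i < j \<and> j \<le> n \<and> \<sigma> i > \<sigma> j}"

definition descents :: "nat \<Rightarrow> (nat \<Rightarrow> nat) \<Rightarrow> nat set" where
  "descents n \<sigma> = {i \<in> {1..<n}. \<sigma> i > \<sigma> (i + 1)}"

definition maj :: "nat \<Rightarrow> (nat \<Rightarrow> nat) \<Rightarrow> nat" where
  "maj n \<sigma> = \<Sum>(descents n \<sigma>)"

definition odd_descents :: "nat \<Rightarrow> (nat \<Rightarrow> nat) \<Rightarrow> nat" where
  "odd_descents n \<sigma> = card {i \<in> descents n \<sigma>. odd i}"

definition even_descents :: "nat \<Rightarrow> (nat \<Rightarrow> nat) \<Rightarrow> nat" where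
  "even_descents n \<sigma> = card {i \<in> descents n \<sigma>. even i}"

definition one_line :: "nat \<Rightarrow> (nat \<Rightarrow> nat) \<Rightarrow> nat list" where
  "one_line n \<sigma> = map \<sigma> [1..<n + 1]"

definition lex_rank :: "nat \<Rightarrow> (nat \<Rightarrow> nat) \<Rightarrow> nat" where
  "lex_rank n \<sigma> = 1 + card {\<tau> \<in> Sym n. (one_line n \<tau>, one_line n \<sigma>) \<in> lexord {(a, b). a < b}}"

text \<open>For \<open>i > n\<close> (no \<open>i\<close>-th entry) the value is \<open>0\<close>.\<close>
definition lehmer :: "nat \<Rightarrow> (nat \<Rightarrow> nat) \<Rightarrow> nat \<Rightarrow> nat" where
  "lehmer n \<sigma> i = card {j. i < j \<and> j \<le> n \<and> \<sigma> j < \<sigma> i}"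

definition has_staircase :: "nat \<Rightarrow> (nat \<Rightarrow> nat) \<Rightarrow> nat \<Rightarrow> bool" where
  "has_staircase n \<sigma> k \<longleftrightarrow>
     (\<exists>idx :: nat \<Rightarrow> nat.
        (\<forall>j\<in>{1..k}. idx j \<in> {1..n} \<and> lehmer n \<sigma> (idx j) \<ge> j) \<and>
        (\<forall>j\<in>{1..<k}. idx (j + 1) < idx j))"

definition staircase_size :: "nat \<Rightarrow> (nat \<Rightarrow> nat) \<Rightarrow> nat" where
  "staircase_size n \<sigma> = Max {k. has_staircase n \<sigma> k}"

text \<open>Occurrences of the vincular pattern \<open>ab-c\<close>.\<close>
definition vincular_occ :: "nat \<Rightarrow> (nat \<Rightarrow> nat) \<Rightarrow> nat \<times> nat \<times> nat \<Rightarrow> nat" where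
  "vincular_occ n \<sigma> = (\<lambda>(a, b, c). card {(i, k). 1 \<le> i \<and> i + 1 < k \<and> k \<le> n \<and>
     (\<sigma> i < \<sigma> (i + 1) \<longleftrightarrow> a < b) \<and> (\<sigma> i < \<sigma> k \<longleftrightarrow> a < c) \<and> (\<sigma> (i + 1) < \<sigma> k \<longleftrightarrow> b < c)})"

definition bs_stat :: "nat \<Rightarrow> (nat \<Rightarrow> nat) \<Rightarrow> nat" where
  "bs_stat n \<sigma> = vincular_occ n \<sigma> (1, 3, 2) + vincular_occ n \<sigma> (2, 1, 3)
     + vincular_occ n \<sigma> (3, 2, 1) + card (descents n \<sigma>)"

definition walk_height :: "nat \<Rightarrow> (nat \<Rightarrow> nat) \<Rightarrow> nat \<Rightarrow> int" where
  "walk_height n \<sigma> m = (\<Sum>i=1..m. if i \<in> descents n \<sigma> then - 1 else 1)"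

definition nonneg_steps :: "nat \<Rightarrow> (nat \<Rightarrow> nat) \<Rightarrow> nat" where
  "nonneg_steps n \<sigma> =
     card {i \<in> {1..<n}. walk_height n \<sigma> (i - 1) \<ge> 0 \<and> walk_height n \<sigma> i \<ge> 0}"

lemma finite_Sym: "finite (Sym n)"
  by (simp add: Sym_def finite_permutations)

lemma reverse_perm_in_Sym:
  assumes "\<sigma> \<in> Sym n" shows "reverse_perm n \<sigma> \<in> Sym n"
proof -
  have p: "\<sigma> permutes {1..n}" using assms by (simp add: Sym_def)
  have r: "bij_betw (\<lambda>i. n + 1 - i) {1..n} {1..n}"
    by (rule bij_betw_byWitness[where f' = "\<lambda>i. n + 1 - i"]) auto
  have "bij_betw (\<sigma> \<circ> (\<lambda>i. n + 1 - i)) {1..n} {1..n}"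
    by (rule bij_betw_trans[OF r permutes_imp_bij[OF p]])
  then have "bij_betw (reverse_perm n \<sigma>) {1..n} {1..n}"
    by (rule bij_betw_cong[THEN iffD1, rotated]) (simp add: reverse_perm_def)
  then show ?thesis
    unfolding Sym_def by (auto intro!: bij_imp_permutes simp: reverse_perm_def)
qed

lemma complement_perm_in_Sym:
  assumes "\<sigma> \<in> Sym n" shows "complement_perm n \<sigma> \<in> Sym n"
proof -
  have p: "\<sigma> permutes {1..n}" using assms by (simp add: Sym_def)
  have r: "bij_betw (\<lambda>i. n + 1 - i) {1..n} {1..n}"
    by (rule bij_betw_byWitness[where f' = "\<lambda>i. n + 1 - i"]) auto
  have "bij_betw ((\<lambda>i. n + 1 - i) \<circ> \<sigma>) {1..n} {1..n}"
    by (rule bij_betw_trans[OF permutes_imp_bij[OF p] r])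
  then have "bij_betw (complement_perm n \<sigma>) {1..n} {1..n}"
    by (rule bij_betw_cong[THEN iffD1, rotated]) (simp add: complement_perm_def)
  then show ?thesis
    unfolding Sym_def by (auto intro!: bij_imp_permutes simp: complement_perm_def)
qed

lemma reverse_perm_involution:
  assumes "\<sigma> \<in> Sym n" shows "reverse_perm n (reverse_perm n \<sigma>) = \<sigma>"
proof
  fix i
  show "reverse_perm n (reverse_perm n \<sigma>) i = \<sigma> i"
    using assms permutes_not_in[of \<sigma> "{1..n}" i]
    by (cases "i \<in> {1..n}") (auto simp: reverse_perm_def Sym_def)
qed

lemma complement_perm_involution:
  assumes "\<sigma> \<in> Sym n" shows "complement_perm n (complement_perm n \<sigma>) = \<sigma>"
proof
  fix i
  show "complement_perm n (complement_perm n \<sigma>) i = \<sigma> i"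
    using assms permutes_not_in[of \<sigma> "{1..n}" i] permutes_in_image[of \<sigma> "{1..n}" i]
    by (cases "i \<in> {1..n}") (auto simp: complement_perm_def Sym_def)
qed

lemma bij_betw_reverse: "bij_betw (reverse_perm n) (Sym n) (Sym n)"
  by (rule bij_betw_byWitness[where f' = "reverse_perm n"])
    (auto simp: reverse_perm_in_Sym reverse_perm_involution)

lemma bij_betw_complement: "bij_betw (complement_perm n) (Sym n) (Sym n)"
  by (rule bij_betw_byWitness[where f' = "complement_perm n"])
    (auto simp: complement_perm_in_Sym complement_perm_involution)

lemma has_staircase_0: "has_staircase n \<sigma> 0"
  by (simp add: has_staircase_def)

lemma finite_has_staircase: "finite {k. has_staircase n \<sigma> k}"
proof (rule finite_subset)
  show "{k. has_staircase n \<sigma> k} \<subseteq> {..n}"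
  proof
    fix k assume "k \<in> {k. has_staircase n \<sigma> k}"
    then obtain idx where i: "\<forall>j\<in>{1..k}. idx j \<in> {1..n} \<and> lehmer n \<sigma> (idx j) \<ge> j"
      by (auto simp: has_staircase_def)
    show "k \<in> {..n}"
    proof (cases "k = 0")
      case False
      then have "k \<le> lehmer n \<sigma> (idx k)" using i by auto
      also have "\<dots> \<le> card {1..n}"
        unfolding lehmer_def by (rule card_mono) auto
      finally show ?thesis by simp
    qed simp
  qed
qed simp

end

theory Submission
  imports Defs
begin

text \<open>
  Averages over the orbits of an involution \<open>X\<close> are constant iff \<open>f x + f (X x)\<close> is. Complementing a
  permutation swaps ascents with descents and inversions with non-inversions, so for every
  statistic but the staircase size the sum is constant because each elementary event is counted
  exactly once for \<open>\<sigma>\<close> or for its complement. The staircase size is computed by scanning the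
  Lehmer code from right to left and extending the staircase whenever possible; in
  each step but the first exactly one of the scans for \<open>\<sigma>\<close> and its complement succeeds, so the two
  sizes add up to \<open>n - 1\<close>. Non-homomesy under reversal is witnessed by two reversal orbits in
  \<open>S\<^sub>3\<close>, \<open>S\<^sub>4\<close> or, for the staircase size, \<open>S\<^sub>5\<close>.
\<close>

section \<open>Homomesy for involutions\<close>

lemma orbit_involution:
  assumes "X (X x) = x"
  shows "orbit X x = {x, X x}"
proof
  show "orbit X x \<subseteq> {x, X x}"
  proof
    fix y assume "y \<in> orbit X x"
    then show "y \<in> {x, X x}" by induction (use assms in auto)
  qed
  have "X x \<in> orbit X x" by (rule orbit.base)
  moreover from orbit.step[OF this] have "x \<in> orbit X x" using assms by simp
  ultimately show "{x, X x} \<subseteq> orbit X x" by simp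
qed

text \<open>Orbits have one or two points. At a fixed point the average is \<open>f x\<close>, which
  still equals half of \<open>f x + f (X x)\<close>, so the same formula covers both orbit
  sizes.\<close>

lemma homomesic_involution_iff:
  assumes "\<And>x. x \<in> S \<Longrightarrow> X (X x) = x"
  shows "homomesic S X f \<longleftrightarrow> (\<exists>c. \<forall>x\<in>S. f x + f (X x) = c)"
proof -
  have avg: "1 / real (card (orbit X x)) * (\<Sum>y\<in>orbit X x. real_of_int (f y))
      = real_of_int (f x + f (X x)) / 2" if "x \<in> S" for x
    using orbit_involution[of X x, OF assms[OF that]] by (cases "X x = x") auto
  have "homomesic S X f \<longleftrightarrow> (\<exists>c. \<forall>x\<in>S. real_of_int (f x + f (X x)) / 2 = c)"
    unfolding homomesic_def ball_simps(9) by (simp only: avg cong: ball_cong)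
  also have "\<dots> \<longleftrightarrow> (\<exists>c. \<forall>x\<in>S. f x + f (X x) = c)"
  proof
    assume "\<exists>c. \<forall>x\<in>S. real_of_int (f x + f (X x)) / 2 = c"
    then obtain c where c: "\<forall>x\<in>S. real_of_int (f x + f (X x)) / 2 = c" ..
    \<comment> \<open>The constant \<open>c\<close> is only known to be real; the floor gives an
      integer witness also for empty \<open>S\<close>.\<close>
    have "\<forall>x\<in>S. f x + f (X x) = \<lfloor>2 * c\<rfloor>"
    proof
      fix x assume "x \<in> S"
      with c have "2 * c = real_of_int (f x + f (X x))" by auto
      then show "f x + f (X x) = \<lfloor>2 * c\<rfloor>" by (simp only: floor_of_int)
    qed
    then show "\<exists>c. \<forall>x\<in>S. f x + f (X x) = c" ..
  next
    assume "\<exists>c. \<forall>x\<in>S. f x + f (X x) = c"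
    then obtain c where "\<forall>x\<in>S. f x + f (X x) = c" ..
    then have "\<forall>x\<in>S. real_of_int (f x + f (X x)) / 2 = real_of_int c / 2" by simp
    then show "\<exists>c. \<forall>x\<in>S. real_of_int (f x + f (X x)) / 2 = c" ..
  qed
  finally show ?thesis .
qed

lemma homomesic_complementI:
  assumes "\<And>\<sigma>. \<sigma> \<in> Sym n \<Longrightarrow> f \<sigma> + f (complement_perm n \<sigma>) = c"
  shows "homomesic (Sym n) (complement_perm n) f"
  using assms by (auto simp: homomesic_involution_iff complement_perm_involution)

lemma not_homomesic_reverseI:
  assumes "\<sigma> \<in> Sym n" "\<tau> \<in> Sym n"
    and "f \<sigma> + f (reverse_perm n \<sigma>) \<noteq> f \<tau> + f (reverse_perm n \<tau>)"
  shows "\<not> homomesic (Sym n) (reverse_perm n) f"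
  using assms by (force simp: homomesic_involution_iff reverse_perm_involution)

section \<open>Statistics of the complement\<close>

lemma Sym_eq_iff: "\<sigma> \<in> Sym n \<Longrightarrow> \<sigma> i = \<sigma> j \<longleftrightarrow> i = j"
  by (auto simp: Sym_def dest: permutes_inj injD)

lemma Sym_in_range: "\<sigma> \<in> Sym n \<Longrightarrow> i \<in> {1..n} \<Longrightarrow> \<sigma> i \<in> {1..n}"
  by (simp add: Sym_def permutes_in_image del: atLeastAtMost_iff)

lemma complement_less_iff:
  assumes "\<sigma> \<in> Sym n" "i \<in> {1..n}" "j \<in> {1..n}"
  shows "complement_perm n \<sigma> i < complement_perm n \<sigma> j \<longleftrightarrow> \<sigma> j < \<sigma> i"
  using Sym_in_range[OF assms(1,2)] Sym_in_range[OF assms(1,3)] assms(2,3)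
  by (auto simp: complement_perm_def)

text \<open>At distinct positions the entries differ, so reversing the order is the same as negating
  it. This is the form needed to split a set of events into two complementary halves.\<close>

lemma complement_less_iff_not_less:
  assumes "\<sigma> \<in> Sym n" "i \<in> {1..n}" "j \<in> {1..n}" "i \<noteq> j"
  shows "complement_perm n \<sigma> i < complement_perm n \<sigma> j \<longleftrightarrow> \<not> \<sigma> i < \<sigma> j"
  using complement_less_iff[OF assms(1-3)] Sym_eq_iff[OF assms(1), of i j] assms(4) by auto

lemma complement_entry_add:
  assumes "\<sigma> \<in> Sym n" "i \<in> {1..n}"
  shows "\<sigma> i + complement_perm n \<sigma> i = n + 1"
  using Sym_in_range[OF assms] assms(2) by (auto simp: complement_perm_def)

lemma card_filter_add_complementary:
  assumes "finite A" "\<And>x. x \<in> A \<Longrightarrow> Q x \<longleftrightarrow> \<not> P x"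
  shows "card {x \<in> A. P x} + card {x \<in> A. Q x} = card A"
proof -
  have "card ({x \<in> A. P x} \<union> {x \<in> A. Q x}) = card {x \<in> A. P x} + card {x \<in> A. Q x}"
    using assms by (intro card_Un_disjoint) auto
  moreover have "{x \<in> A. P x} \<union> {x \<in> A. Q x} = A" using assms(2) by auto
  ultimately show ?thesis by simp
qed

text \<open>Each of the \<open>n - i\<close> positions to the right of \<open>i\<close> is counted
  for exactly one of the two permutations. Truncated subtraction keeps this correct for
  \<open>i > n\<close>, where both code entries are 0; the second and third entries need this for
  small \<open>n\<close>.\<close>

lemma lehmer_complement:
  assumes "\<sigma> \<in> Sym n" "i \<ge> 1"
  shows "lehmer n \<sigma> i + lehmer n (complement_perm n \<sigma>) i = n - i"
proof -
  have eq: "lehmer n \<rho> i = card {j \<in> {i<..n}. \<rho> j < \<rho> i}" for \<rho>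
    unfolding lehmer_def by (rule arg_cong[where f = card]) auto
  have "card {j \<in> {i<..n}. \<sigma> j < \<sigma> i}
      + card {j \<in> {i<..n}. complement_perm n \<sigma> j < complement_perm n \<sigma> i} = card {i<..n}"
    by (rule card_filter_add_complementary)
      (use assms in \<open>auto simp: complement_less_iff_not_less\<close>)
  then show ?thesis by (simp add: eq)
qed

lemma inversions_complement:
  assumes "\<sigma> \<in> Sym n"
  shows "inversions n \<sigma> + inversions n (complement_perm n \<sigma>)
    = card {(i, j). 1 \<le> i \<and> i < j \<and> j \<le> n}"
proof -
  let ?A = "{(i, j). 1 \<le> i \<and> i < j \<and> j \<le> n}"
  have eq: "inversions n \<rho> = card {p \<in> ?A. \<rho> (snd p) < \<rho> (fst p)}" for \<rho>
    unfolding inversions_def by (rule arg_cong[where f = card]) auto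
  have "finite ?A" by (rule finite_subset[of _ "{1..n} \<times> {1..n}"]) auto
  then have "card {p \<in> ?A. \<sigma> (snd p) < \<sigma> (fst p)}
      + card {p \<in> ?A. complement_perm n \<sigma> (snd p) < complement_perm n \<sigma> (fst p)} = card ?A"
    by (rule card_filter_add_complementary)
      (use assms in \<open>auto simp: complement_less_iff_not_less\<close>)
  then show ?thesis by (simp add: eq)
qed

section \<open>Descent sets and weighted descent sums\<close>

lemma descents_complement:
  assumes "\<sigma> \<in> Sym n"
  shows "descents n (complement_perm n \<sigma>) = {1..<n} - descents n \<sigma>"
  using assms by (auto simp: descents_def complement_less_iff_not_less)

lemma descents_subset: "descents n \<sigma> \<subseteq> {1..<n}"
  by (auto simp: descents_def)

text \<open>The weight is left open for several uses: the identity gives \<open>maj\<close>, parity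
  indicators give the odd and even descents, and the constant 1 gives the number of
  descents.\<close>

lemma sum_descents_complement:
  fixes w :: "nat \<Rightarrow> nat"
  assumes "\<sigma> \<in> Sym n"
  shows "sum w (descents n \<sigma>) + sum w (descents n (complement_perm n \<sigma>)) = sum w {1..<n}"
  using sum.subset_diff[OF descents_subset[of n \<sigma>], of w]
  by (simp add: descents_complement[OF assms])

lemma card_descents_eq_sum:
  "card {i \<in> descents n \<sigma>. P i} = (\<Sum>i\<in>descents n \<sigma>. of_bool (P i))"
  using finite_subset[OF descents_subset] by (simp add: Int_def)

lemma maj_complement:
  assumes "\<sigma> \<in> Sym n"
  shows "maj n \<sigma> + maj n (complement_perm n \<sigma>) = \<Sum>{1..<n}"
  using sum_descents_complement[OF assms, of "\<lambda>i. i"] by (simp add: maj_def)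

lemma odd_descents_complement:
  assumes "\<sigma> \<in> Sym n"
  shows "odd_descents n \<sigma> + odd_descents n (complement_perm n \<sigma>) = (\<Sum>i\<in>{1..<n}. of_bool (odd i))"
  unfolding odd_descents_def card_descents_eq_sum by (rule sum_descents_complement[OF assms])

lemma even_descents_complement:
  assumes "\<sigma> \<in> Sym n"
  shows "even_descents n \<sigma> + even_descents n (complement_perm n \<sigma>) = (\<Sum>i\<in>{1..<n}. of_bool (even i))"
  unfolding even_descents_def card_descents_eq_sum by (rule sum_descents_complement[OF assms])

text \<open>Indicator sums over a common index set allow the pattern counts of a permutation and its
  complement to be added pair by pair.\<close>

lemma vincular_occ_eq_sum:
  "vincular_occ n \<sigma> (a, b, c) = (\<Sum>(i, k)\<in>{(i, k). 1 \<le> i \<and> i + 1 < k \<and> k \<le> n}.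
     of_bool ((\<sigma> i < \<sigma> (i + 1) \<longleftrightarrow> a < b) \<and> (\<sigma> i < \<sigma> k \<longleftrightarrow> a < c) \<and> (\<sigma> (i + 1) < \<sigma> k \<longleftrightarrow> b < c)))"
proof -
  let ?A = "{(i, k). 1 \<le> i \<and> i + 1 < k \<and> k \<le> n}"
  have "finite ?A" by (rule finite_subset[of _ "{1..n} \<times> {1..n}"]) auto
  then show ?thesis
    by (auto simp: vincular_occ_def case_prod_beta intro!: arg_cong[where f = card])
qed

text \<open>The complements of \<open>13-2\<close>, \<open>21-3\<close>, \<open>32-1\<close> are \<open>31-2\<close>, \<open>23-1\<close>, \<open>12-3\<close>: together these are all
  six patterns, so each pair \<open>(i, k)\<close> is counted exactly once.\<close>

lemma bs_stat_complement:
  assumes "\<sigma> \<in> Sym n"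
  shows "bs_stat n \<sigma> + bs_stat n (complement_perm n \<sigma>)
    = card {(i, k). 1 \<le> i \<and> i + 1 < k \<and> k \<le> n} + (n - 1)"
proof -
  let ?A = "{(i, k). 1 \<le> i \<and> i + 1 < k \<and> k \<le> n}"
  let ?v = "\<lambda>\<rho>. vincular_occ n \<rho> (1, 3, 2) + vincular_occ n \<rho> (2, 1, 3) + vincular_occ n \<rho> (3, 2, 1)"
  have "?v \<sigma> + ?v (complement_perm n \<sigma>) = (\<Sum>p\<in>?A. 1)"
    unfolding vincular_occ_eq_sum sum.distrib[symmetric]
  proof (rule sum.cong[OF refl], goal_cases)
    case (1 p)
    then obtain i k where p: "p = (i, k)" and ik: "i \<in> {1..n}" "i + 1 \<in> {1..n}" "k \<in> {1..n}"
      "i \<noteq> i + 1" "i \<noteq> k" "i + 1 \<noteq> k" by auto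
    have ne: "\<sigma> i \<noteq> \<sigma> (i + 1)" "\<sigma> i \<noteq> \<sigma> k" "\<sigma> (i + 1) \<noteq> \<sigma> k"
      using ik(4-6) by (simp_all add: Sym_eq_iff[OF assms])
    note less = complement_less_iff_not_less[OF assms ik(1,2,4)]
      complement_less_iff_not_less[OF assms ik(1,3,5)]
      complement_less_iff_not_less[OF assms ik(2,3,6)]
    show ?case
      unfolding p prod.case less
      \<comment> \<open>Of the eight truth patterns, six are the relative orders of three entries;
        the two cyclic ones contradict linearity.\<close>
      using ne by (cases "\<sigma> i < \<sigma> (i + 1)"; cases "\<sigma> i < \<sigma> k"; cases "\<sigma> (i + 1) < \<sigma> k") simp_all
  qed
  then show ?thesis
    using sum_descents_complement[OF assms, of "\<lambda>_. 1"] by (simp add: bs_stat_def)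
qed

section \<open>The associated walk\<close>

lemma walk_height_Suc:
  "walk_height n \<sigma> (Suc m) = walk_height n \<sigma> m + (if Suc m \<in> descents n \<sigma> then - 1 else 1)"
  by (simp add: walk_height_def)

text \<open>The walk is reflected in the axis. The bound \<open>m < n\<close> matters:
  \<open>walk_height\<close> counts every position from \<open>n\<close> on as an up step for both
  permutations.\<close>

lemma walk_height_complement:
  assumes "\<sigma> \<in> Sym n" "m < n"
  shows "walk_height n (complement_perm n \<sigma>) m = - walk_height n \<sigma> m"
  using assms(2)
proof (induction m)
  case 0
  then show ?case by (simp add: walk_height_def)
next
  case (Suc m)
  then show ?case by (simp add: walk_height_Suc descents_complement[OF assms(1)])
qed

text \<open>A step of length one cannot cross height 0, so it lies on exactly one side of the axis,
  and reflection exchanges the sides.\<close>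

lemma nonneg_steps_complement:
  assumes "\<sigma> \<in> Sym n"
  shows "nonneg_steps n \<sigma> + nonneg_steps n (complement_perm n \<sigma>) = n - 1"
proof -
  let ?P = "\<lambda>\<rho> i. walk_height n \<rho> (i - 1) \<ge> 0 \<and> walk_height n \<rho> i \<ge> 0"
  have "card {i \<in> {1..<n}. ?P \<sigma> i} + card {i \<in> {1..<n}. ?P (complement_perm n \<sigma>) i} = card {1..<n}"
  proof (rule card_filter_add_complementary)
    fix i assume i: "i \<in> {1..<n}"
    then obtain m where m: "i = Suc m" by (cases i) auto
    show "?P (complement_perm n \<sigma>) i \<longleftrightarrow> \<not> ?P \<sigma> i"
      using i walk_height_complement[OF assms, of m] walk_height_complement[OF assms, of "Suc m"]
      by (auto simp: m walk_height_Suc)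
  qed simp
  then show ?thesis by (simp add: nonneg_steps_def)
qed

subsection \<open>Lexicographic rank\<close>

text \<open>The first position of difference is preserved and the comparison there is flipped. Equal
  lengths exclude proper prefixes, whose order no map of letters would reverse.\<close>

lemma lexord_map_antitone:
  fixes xs ys :: "'a::linorder list" and g :: "'a \<Rightarrow> 'b::linorder"
  assumes "length xs = length ys"
    and "\<And>x y. x \<in> set xs \<union> set ys \<Longrightarrow> y \<in> set xs \<union> set ys \<Longrightarrow> g x < g y \<longleftrightarrow> y < x"
  shows "(map g xs, map g ys) \<in> lexord {(a, b). a < b} \<longleftrightarrow> (ys, xs) \<in> lexord {(a, b). a < b}"
  using assms
proof (induction xs ys rule: list_induct2)
  case (Cons x xs y ys)
  have g: "g x < g y \<longleftrightarrow> y < x" "g y < g x \<longleftrightarrow> x < y" using Cons.prems by simp_all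
  then have "g x = g y \<longleftrightarrow> y = x" by (metis less_irrefl linorder_less_linear)
  with g show ?case using Cons by simp
qed simp

definition lex_less :: "nat \<Rightarrow> (nat \<Rightarrow> nat) \<Rightarrow> (nat \<Rightarrow> nat) \<Rightarrow> bool" where
  "lex_less n \<sigma> \<tau> \<longleftrightarrow> (one_line n \<sigma>, one_line n \<tau>) \<in> lexord {(a, b). a < b}"

lemma lex_rank_eq: "lex_rank n \<sigma> = 1 + card {\<tau> \<in> Sym n. lex_less n \<tau> \<sigma>}"
  by (simp add: lex_rank_def lex_less_def)

lemma lex_less_irrefl: "\<not> lex_less n \<sigma> \<sigma>"
  unfolding lex_less_def by (rule lexord_irreflexive) auto

lemma lex_less_trans: "lex_less n \<rho> \<sigma> \<Longrightarrow> lex_less n \<sigma> \<tau> \<Longrightarrow> lex_less n \<rho> \<tau>"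
  unfolding lex_less_def by (erule lexord_trans) (auto simp: trans_def)

lemma lex_less_total:
  assumes "\<sigma> \<in> Sym n" "\<tau> \<in> Sym n" "\<sigma> \<noteq> \<tau>"
  shows "lex_less n \<sigma> \<tau> \<or> lex_less n \<tau> \<sigma>"
proof -
  have "one_line n \<sigma> \<noteq> one_line n \<tau>"
  proof
    assume "one_line n \<sigma> = one_line n \<tau>"
    then have "\<forall>i\<in>{1..n}. \<sigma> i = \<tau> i" by (auto simp: one_line_def)
    \<comment> \<open>Both permutations are the identity outside \<open>{1..n}\<close>, so the
      one-line word determines them.\<close>
    then have "\<sigma> = \<tau>"
      using assms(1,2) permutes_not_in[of _ "{1..n}"] unfolding Sym_def by (metis ext mem_Collect_eq)
    with assms(3) show False ..
  qed
  then show ?thesis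
    using lexord_linear[of "{(a::nat, b). a < b}" "one_line n \<sigma>" "one_line n \<tau>"] linorder_less_linear
    unfolding lex_less_def by blast
qed

lemma lex_less_complement:
  assumes "\<sigma> \<in> Sym n" "\<tau> \<in> Sym n"
  shows "lex_less n (complement_perm n \<sigma>) (complement_perm n \<tau>) \<longleftrightarrow> lex_less n \<tau> \<sigma>"
proof -
  have eq: "one_line n (complement_perm n \<rho>) = map (\<lambda>x. n + 1 - x) (one_line n \<rho>)" for \<rho>
    by (auto simp: one_line_def complement_perm_def)
  have "set (one_line n \<rho>) \<subseteq> {1..n}" if "\<rho> \<in> Sym n" for \<rho>
  proof -
    have "set (one_line n \<rho>) = \<rho> ` {1..n}"
      by (simp add: one_line_def atLeastLessThanSuc_atLeastAtMost del: upt_Suc)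
    also have "\<dots> \<subseteq> {1..n}" by (intro image_subsetI Sym_in_range[OF that])
    finally show ?thesis .
  qed
  from this[OF assms(1)] this[OF assms(2)] show ?thesis
    unfolding lex_less_def eq
    by (intro lexord_map_antitone) (simp add: one_line_def, force)
qed

text \<open>The smaller set omits \<open>\<sigma>\<close> itself, which the larger one contains.
  This lets ranks be compared without enumerating the symmetric group.\<close>

lemma lex_rank_strict_mono:
  assumes "\<sigma> \<in> Sym n" "lex_less n \<sigma> \<tau>"
  shows "lex_rank n \<sigma> < lex_rank n \<tau>"
proof -
  have "{\<rho> \<in> Sym n. lex_less n \<rho> \<sigma>} \<subset> {\<rho> \<in> Sym n. lex_less n \<rho> \<tau>}"
    using assms lex_less_irrefl lex_less_trans by blast
  then show ?thesis
    unfolding lex_rank_eq by (simp add: psubset_card_mono finite_Sym)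
qed

text \<open>Complementing carries the permutations above \<open>\<sigma>\<close> to those below its
  complement. Together with those below \<open>\<sigma>\<close> they account for everything except
  \<open>\<sigma>\<close>, and the two ranks add 2.\<close>

lemma lex_rank_complement:
  assumes \<sigma>: "\<sigma> \<in> Sym n"
  shows "lex_rank n \<sigma> + lex_rank n (complement_perm n \<sigma>) = card (Sym n) + 1"
proof -
  let ?C = "complement_perm n"
  have "bij_betw ?C {\<tau> \<in> Sym n. lex_less n \<sigma> \<tau>} {\<tau> \<in> Sym n. lex_less n \<tau> (?C \<sigma>)}"
    by (rule bij_betw_byWitness[where f' = ?C])
      (use \<sigma> lex_less_complement[of "?C \<sigma>" n] in
        \<open>auto simp: complement_perm_involution complement_perm_in_Sym lex_less_complement\<close>)
  then have "card {\<tau> \<in> Sym n. lex_less n \<tau> (?C \<sigma>)} = card {\<tau> \<in> Sym n. lex_less n \<sigma> \<tau>}"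
    by (simp add: bij_betw_same_card)
  moreover have "card {\<tau> \<in> Sym n - {\<sigma>}. lex_less n \<tau> \<sigma>} + card {\<tau> \<in> Sym n - {\<sigma>}. lex_less n \<sigma> \<tau>}
      = card (Sym n - {\<sigma>})"
    by (rule card_filter_add_complementary)
      (use \<sigma> lex_less_total lex_less_irrefl lex_less_trans finite_Sym in blast)+
  moreover have "{\<tau> \<in> Sym n - {\<sigma>}. lex_less n \<tau> \<sigma>} = {\<tau> \<in> Sym n. lex_less n \<tau> \<sigma>}"
    "{\<tau> \<in> Sym n - {\<sigma>}. lex_less n \<sigma> \<tau>} = {\<tau> \<in> Sym n. lex_less n \<sigma> \<tau>}"
    using lex_less_irrefl by auto
  moreover have "card (Sym n) = Suc (card (Sym n - {\<sigma>}))"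
    using \<sigma> by (intro card.remove finite_Sym)
  ultimately show ?thesis by (simp add: lex_rank_eq)
qed

subsection \<open>Staircase size\<close>

text \<open>On an ascending list \<open>foldr\<close> treats the largest position first, matching
  the convention that step 1 of a staircase sits rightmost.\<close>

definition greedy_staircase :: "(nat \<Rightarrow> nat) \<Rightarrow> nat list \<Rightarrow> nat" where
  "greedy_staircase L is = foldr (\<lambda>i h. if h < L i then Suc h else h) is 0"

lemma greedy_staircase_simps [simp]:
  "greedy_staircase L [] = 0"
  "greedy_staircase L (i # is) =
    (let h = greedy_staircase L is in if h < L i then Suc h else h)"
  by (simp_all add: greedy_staircase_def)

text \<open>Greedy is optimal: a staircase of size \<open>k\<close> that uses \<open>m\<close>
  leaves one of size \<open>k - 1\<close> further right and needs \<open>k \<le> L m\<close>.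
  Stating the equivalence for every \<open>k\<close> makes the induction hypothesis available at
  \<open>k - 1\<close> too.\<close>

lemma staircase_from_iff_greedy:
  assumes "m \<le> Suc n"
  shows "(\<exists>idx. (\<forall>j\<in>{1..k}. idx j \<in> {m..n} \<and> j \<le> L (idx j)) \<and>
                (\<forall>j\<in>{1..<k}. idx (j + 1) < idx j))
    \<longleftrightarrow> k \<le> greedy_staircase L [m..<Suc n]"
    (is "(\<exists>idx. ?S m k idx) \<longleftrightarrow> _")
  using assms
proof (induction m arbitrary: k rule: inc_induct)
  case base
  show ?case by (cases k) auto
next
  case (step m)
  let ?h = "greedy_staircase L [Suc m..<Suc n]"
  have g: "greedy_staircase L [m..<Suc n] = (if ?h < L m then Suc ?h else ?h)"
    using step.hyps by (simp add: upt_conv_Cons Let_def del: upt_Suc)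
  show ?case
  proof
    assume "\<exists>idx. ?S m k idx"
    then obtain idx where idx: "?S m k idx" ..
    \<comment> \<open>Strict decrease accumulates, so only the last index \<open>idx k\<close> can
      equal the left end \<open>m\<close>.\<close>
    have decr: "idx k + (k - j) \<le> idx j" if "1 \<le> j" "j \<le> k" for j
      using that(2,1)
    proof (induction rule: inc_induct)
      case (step j)
      then have "idx (j + 1) < idx j" using idx by auto
      with step show ?case by auto
    qed simp
    show "k \<le> greedy_staircase L [m..<Suc n]"
    proof (cases "k > 0 \<and> idx k = m")
      case True
      then obtain k' where k: "k = Suc k'" by (cases k) auto
      have "m < idx j" if "j \<in> {1..k'}" for j
        using decr[of j] that True by (auto simp: k)
      then have "?S (Suc m) k' idx" using idx by (auto simp: k Suc_le_eq)
      then have "k' \<le> ?h" using step.IH by blast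
      moreover have "k \<le> L m" using idx True by auto
      ultimately show ?thesis unfolding g k by auto
    next
      case False
      have "m < idx j" if "j \<in> {1..k}" for j
      proof -
        have "m \<le> idx k" "idx k \<noteq> m" using idx False that by auto
        then show ?thesis using decr[of j] that by auto
      qed
      then have "?S (Suc m) k idx" using idx by (auto simp: Suc_le_eq)
      then have "k \<le> ?h" using step.IH by blast
      then show ?thesis unfolding g by simp
    qed
  next
    assume k: "k \<le> greedy_staircase L [m..<Suc n]"
    show "\<exists>idx. ?S m k idx"
    proof (cases "k \<le> ?h")
      case True
      then obtain idx where "?S (Suc m) k idx" using step.IH by blast
      then have "?S m k idx" by force
      then show ?thesis by blast
    next
      case False
      \<comment> \<open>As \<open>k\<close> exceeds \<open>?h\<close> but not the new greedy value,
        the scan must have succeeded at \<open>m\<close>; position \<open>m\<close> is then added as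
        the last index.\<close>
      then obtain h where k: "k = Suc h" "h < L m" and h: "h = ?h"
        using k unfolding g by (auto split: if_splits simp del: upt_Suc)
      obtain idx where idx: "?S (Suc m) h idx" using step.IH[of h] h by blast
      have "?S m k (idx(k := m))"
      proof (intro conjI ballI)
        fix j assume "j \<in> {1..k}"
        then show "(idx(k := m)) j \<in> {m..n}" "j \<le> L ((idx(k := m)) j)"
          using idx k step.hyps by (cases "j = k"; force)+
      next
        fix j assume "j \<in> {1..<k}"
        then show "(idx(k := m)) (j + 1) < (idx(k := m)) j"
          using idx k by (cases "j = h") (auto simp: Suc_le_eq)
      qed
      then show ?thesis by blast
    qed
  qed
qed

lemma staircase_size_eq_greedy:
  "staircase_size n \<sigma> = greedy_staircase (lehmer n \<sigma>) [1..<Suc n]"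
proof -
  have "{k. has_staircase n \<sigma> k} = {..greedy_staircase (lehmer n \<sigma>) [1..<Suc n]}"
    unfolding has_staircase_def using staircase_from_iff_greedy[of 1 n _ "lehmer n \<sigma>"]
    by (simp add: atMost_def del: upt_Suc)
  moreover have "Max {..k} = k" for k :: nat by (intro Max_eqI) auto
  ultimately show ?thesis by (simp only: staircase_size_def)
qed

text \<open>For \<open>m < n\<close>, \<open>h + h' = n - m - 1\<close> and
  \<open>L m + L' m = n - m\<close> give \<open>h' < L' m\<close> iff \<open>L m \<le> h\<close>, so
  exactly one scan advances. At \<open>m = n\<close> both entries are 0 and neither does.\<close>

lemma greedy_staircase_add:
  assumes "m \<le> Suc n" "\<And>i. m \<le> i \<Longrightarrow> i \<le> n \<Longrightarrow> L i + L' i = n - i"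
  shows "greedy_staircase L [m..<Suc n] + greedy_staircase L' [m..<Suc n] = n - m"
  using assms
proof (induction m rule: inc_induct)
  case (step m)
  let ?h = "greedy_staircase L [Suc m..<Suc n]" and ?h' = "greedy_staircase L' [Suc m..<Suc n]"
  have IH: "?h + ?h' = n - Suc m" using step by auto
  have L: "L m + L' m = n - m" using step by simp
  have "[m..<Suc n] = m # [Suc m..<Suc n]" using step.hyps by (simp add: upt_conv_Cons del: upt_Suc)
  then show ?case using IH L step.hyps by (auto simp: Let_def simp del: upt_Suc)
qed simp

lemma staircase_size_complement:
  assumes "\<sigma> \<in> Sym n"
  shows "staircase_size n \<sigma> + staircase_size n (complement_perm n \<sigma>) = n - 1"
  unfolding staircase_size_eq_greedy
  by (rule greedy_staircase_add) (simp_all add: lehmer_complement[OF assms])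

section \<open>Explicit permutations\<close>

definition word_perm :: "nat list \<Rightarrow> nat \<Rightarrow> nat" where
  "word_perm w i = (if i \<in> {1..length w} then w ! (i - 1) else i)"

lemma word_perm_in_Sym:
  assumes "length w = n" "distinct w" "set w \<subseteq> {1..n}"
  shows "word_perm w \<in> Sym n"
proof -
  have set_w: "set w = {1..n}"
    using assms by (intro card_subset_eq) (simp_all add: distinct_card)
  have "bij_betw (\<lambda>i. i - 1) {1..n} {..<n}"
    by (rule bij_betw_byWitness[where f' = Suc]) auto
  moreover have "bij_betw ((!) w) {..<n} {1..n}"
    using assms set_w by (intro bij_betw_nth) auto
  ultimately have "bij_betw ((!) w \<circ> (\<lambda>i. i - 1)) {1..n} {1..n}"
    by (rule bij_betw_trans)
  then have "bij_betw (word_perm w) {1..n} {1..n}"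
    by (rule bij_betw_cong[THEN iffD1, rotated]) (simp add: word_perm_def assms(1))
  then show ?thesis
    unfolding Sym_def by (auto intro!: bij_imp_permutes simp: word_perm_def assms(1))
qed

lemma reverse_word_perm: "length w = n \<Longrightarrow> reverse_perm n (word_perm w) = word_perm (rev w)"
  by (auto simp: fun_eq_iff reverse_perm_def word_perm_def rev_nth)

section \<open>Statistics as list sums, for evaluation on explicit words\<close>

lemma card_filter_upt: "card {i \<in> {a..<b}. P i} = (\<Sum>i\<leftarrow>[a..<b]. of_bool (P i))"
  by (simp add: interv_sum_list_conv_sum_set_nat Int_def)

lemma lehmer_eq_sum_list: "lehmer n \<sigma> i = (\<Sum>j\<leftarrow>[Suc i..<Suc n]. of_bool (\<sigma> j < \<sigma> i))"
  unfolding lehmer_def card_filter_upt[symmetric] by (rule arg_cong[where f = card]) auto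

lemma maj_eq_sum_list: "maj n \<sigma> = (\<Sum>i\<leftarrow>[1..<n]. if \<sigma> (i + 1) < \<sigma> i then i else 0)"
  unfolding maj_def descents_def interv_sum_list_conv_sum_set_nat
  by (simp add: sum.inter_filter[symmetric])

lemma card_descents_eq_sum_list: "card (descents n \<sigma>) = (\<Sum>i\<leftarrow>[1..<n]. of_bool (\<sigma> (i + 1) < \<sigma> i))"
  unfolding descents_def card_filter_upt ..

lemma odd_descents_eq_sum_list:
  "odd_descents n \<sigma> = (\<Sum>i\<leftarrow>[1..<n]. of_bool (\<sigma> (i + 1) < \<sigma> i \<and> odd i))"
  unfolding odd_descents_def descents_def card_filter_upt[symmetric]
  by (rule arg_cong[where f = card]) auto

lemma even_descents_eq_sum_list:
  "even_descents n \<sigma> = (\<Sum>i\<leftarrow>[1..<n]. of_bool (\<sigma> (i + 1) < \<sigma> i \<and> even i))"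
  unfolding even_descents_def descents_def card_filter_upt[symmetric]
  by (rule arg_cong[where f = card]) auto

lemma inversions_eq_sum_list: "inversions n \<sigma> = (\<Sum>i\<leftarrow>[1..<Suc n]. lehmer n \<sigma> i)"
proof -
  have "inversions n \<sigma> = card (SIGMA i:{1..<Suc n}. {j. i < j \<and> j \<le> n \<and> \<sigma> j < \<sigma> i})"
    unfolding inversions_def by (rule arg_cong[where f = card]) auto
  then show ?thesis
    by (simp add: interv_sum_list_conv_sum_set_nat lehmer_def del: upt_Suc)
qed

lemma vincular_occ_eq_sum_list:
  "vincular_occ n \<sigma> (a, b, c) = (\<Sum>i\<leftarrow>[1..<n]. \<Sum>k\<leftarrow>[i + 2..<Suc n].
     of_bool ((\<sigma> i < \<sigma> (i + 1) \<longleftrightarrow> a < b) \<and> (\<sigma> i < \<sigma> k \<longleftrightarrow> a < c) \<and> (\<sigma> (i + 1) < \<sigma> k \<longleftrightarrow> b < c)))"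
proof -
  have "vincular_occ n \<sigma> (a, b, c) = card (SIGMA i:{1..<n}. {k \<in> {i + 2..<Suc n}.
    (\<sigma> i < \<sigma> (i + 1) \<longleftrightarrow> a < b) \<and> (\<sigma> i < \<sigma> k \<longleftrightarrow> a < c) \<and> (\<sigma> (i + 1) < \<sigma> k \<longleftrightarrow> b < c)})"
    unfolding vincular_occ_def prod.case by (rule arg_cong[where f = card]) auto
  also have "\<dots> = (\<Sum>i\<in>{1..<n}. card {k \<in> {i + 2..<Suc n}.
    (\<sigma> i < \<sigma> (i + 1) \<longleftrightarrow> a < b) \<and> (\<sigma> i < \<sigma> k \<longleftrightarrow> a < c) \<and> (\<sigma> (i + 1) < \<sigma> k \<longleftrightarrow> b < c)})"
    by (rule card_SigmaI) auto
  finally show ?thesis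
    unfolding card_filter_upt by (simp add: interv_sum_list_conv_sum_set_nat del: upt_Suc)
qed

lemma nonneg_steps_eq_sum_list:
  "nonneg_steps n \<sigma> =
     (\<Sum>i\<leftarrow>[1..<n]. of_bool (walk_height n \<sigma> (i - 1) \<ge> 0 \<and> walk_height n \<sigma> i \<ge> 0))"
  unfolding nonneg_steps_def card_filter_upt ..

lemma walk_height_eq_sum_list:
  "walk_height n \<sigma> m = (\<Sum>i\<leftarrow>[1..<Suc m]. if i \<in> descents n \<sigma> then - 1 else 1)"
  unfolding walk_height_def interv_sum_list_conv_sum_set_nat by (rule sum.cong) auto

lemma upt_Suc_numeral:
  "Suc m < numeral k \<Longrightarrow> [Suc m..<numeral k] = Suc m # [Suc (Suc m)..<numeral k]"
  by (rule upt_conv_Cons)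

lemma mem_descents_iff: "i \<in> descents n \<sigma> \<longleftrightarrow> 1 \<le> i \<and> i < n \<and> \<sigma> (i + 1) < \<sigma> i"
  by (auto simp: descents_def)

text \<open>Rewriting with these rules computes the statistics of a \<open>word_perm\<close>. The
  rank is left out, since its witnesses are compared by \<open>lex_rank_strict_mono\<close>.\<close>

lemmas stat_eval = lehmer_eq_sum_list inversions_eq_sum_list maj_eq_sum_list
  odd_descents_eq_sum_list even_descents_eq_sum_list bs_stat_def card_descents_eq_sum_list
  vincular_occ_eq_sum_list nonneg_steps_eq_sum_list walk_height_eq_sum_list
  staircase_size_eq_greedy mem_descents_iff word_perm_def upt_Suc_numeral

section \<open>The thirteen statistics\<close>

definition complement_not_reverse_homomesic :: "(nat \<Rightarrow> (nat \<Rightarrow> nat) \<Rightarrow> int) \<Rightarrow> bool" where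
  "complement_not_reverse_homomesic st \<longleftrightarrow>
     (\<forall>n\<ge>1. homomesic (Sym n) (complement_perm n) (st n)) \<and>
     (\<exists>n\<ge>1. \<not> homomesic (Sym n) (reverse_perm n) (st n))"

lemma complement_not_reverse_homomesicI:
  assumes "\<And>n \<sigma>. n \<ge> 1 \<Longrightarrow> \<sigma> \<in> Sym n \<Longrightarrow> st n \<sigma> + st n (complement_perm n \<sigma>) = c n"
    and "length v = n" "distinct v" "set v \<subseteq> {1..n}"
    and "length w = n" "distinct w" "set w \<subseteq> {1..n}"
    and "st n (word_perm v) + st n (word_perm (rev v)) \<noteq> st n (word_perm w) + st n (word_perm (rev w))"
  shows "complement_not_reverse_homomesic st"
  unfolding complement_not_reverse_homomesic_def
proof (intro conjI allI impI)
  show "homomesic (Sym n) (complement_perm n) (st n)" if "n \<ge> 1" for n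
    by (rule homomesic_complementI) (use that assms(1) in blast)
  have "\<not> homomesic (Sym n) (reverse_perm n) (st n)"
    by (rule not_homomesic_reverseI[of "word_perm v" _ "word_perm w"])
      (use assms in \<open>simp_all add: word_perm_in_Sym reverse_word_perm\<close>)
  moreover have "n \<ge> 1"
  proof (rule ccontr)
    assume "\<not> n \<ge> 1"
    then have "n = 0" by simp
    \<comment> \<open>At size 0 there is a single word, so the two sums could not differ.\<close>
    then have "v = []" "w = []" using assms(2,5) by simp_all
    then show False using assms(8) by simp
  qed
  ultimately show "\<exists>n\<ge>1. \<not> homomesic (Sym n) (reverse_perm n) (st n)" by blast
qed

lemma homomesy_lehmer_2:
  "complement_not_reverse_homomesic (\<lambda>n \<sigma>. int (lehmer n \<sigma> 2))"
proof (rule complement_not_reverse_homomesicI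
    [where v = "[1, 2, 3]" and w = "[1, 3, 2]" and n = 3
      and c = "\<lambda>n. int (n - 2)"], goal_cases)
  case (1 n \<sigma>)
  then show ?case using lehmer_complement[of \<sigma> n 2] by linarith
qed (simp_all add: stat_eval)

lemma homomesy_lehmer_3:
  "complement_not_reverse_homomesic (\<lambda>n \<sigma>. int (lehmer n \<sigma> 3))"
\<comment> \<open>The third code entry vanishes on S_3, hence size 4; the reversal sums are 1 and
  2.\<close>
proof (rule complement_not_reverse_homomesicI
    [where v = "[1, 2, 3, 4]" and w = "[1, 2, 4, 3]" and n = 4
      and c = "\<lambda>n. int (n - 3)"], goal_cases)
  case (1 n \<sigma>)
  then show ?case using lehmer_complement[of \<sigma> n 3] by linarith
qed (simp_all add: stat_eval)

lemma homomesy_maj: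
  "complement_not_reverse_homomesic (\<lambda>n \<sigma>. int (maj n \<sigma>))"
\<comment> \<open>The peak in 132 makes 2 the only descent of both 132 and 231, with sum 4; 123 and
  321 give 3.\<close>
proof (rule complement_not_reverse_homomesicI
    [where v = "[1, 2, 3]" and w = "[1, 3, 2]" and n = 3
      and c = "\<lambda>n. int (\<Sum>{1..<n})"], goal_cases)
  case (1 n \<sigma>)
  then show ?case using maj_complement[of \<sigma> n] by linarith
qed (simp_all add: stat_eval)

lemma homomesy_odd_descents:
  "complement_not_reverse_homomesic (\<lambda>n \<sigma>. int (odd_descents n \<sigma>))"
proof (rule complement_not_reverse_homomesicI
    [where v = "[1, 2, 3]" and w = "[1, 3, 2]" and n = 3
      and c = "\<lambda>n. int (\<Sum>i\<in>{1..<n}. of_bool (odd i))"], goal_cases)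
  case (1 n \<sigma>)
  then show ?case using odd_descents_complement[of \<sigma> n] by linarith
qed (simp_all add: stat_eval)

lemma homomesy_even_descents:
  "complement_not_reverse_homomesic (\<lambda>n \<sigma>. int (even_descents n \<sigma>))"
proof (rule complement_not_reverse_homomesicI
    [where v = "[1, 2, 3]" and w = "[1, 3, 2]" and n = 3
      and c = "\<lambda>n. int (\<Sum>i\<in>{1..<n}. of_bool (even i))"], goal_cases)
  case (1 n \<sigma>)
  then show ?case using even_descents_complement[of \<sigma> n] by linarith
qed (simp_all add: stat_eval)

lemma homomesy_lex_rank:
  "complement_not_reverse_homomesic (\<lambda>n \<sigma>. int (lex_rank n \<sigma>))"
proof -
  \<comment> \<open>132 precedes 213 and 231 precedes 312, so the rank sum of the first reversal
    orbit is strictly smaller.\<close>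
  have 1: "lex_rank 3 (word_perm [1, 3, 2]) < lex_rank 3 (word_perm [2, 1, 3])"
    by (rule lex_rank_strict_mono)
      (simp_all add: word_perm_in_Sym lex_less_def one_line_def word_perm_def upt_Suc_numeral)
  have 2: "lex_rank 3 (word_perm [2, 3, 1]) < lex_rank 3 (word_perm [3, 1, 2])"
    by (rule lex_rank_strict_mono)
      (simp_all add: word_perm_in_Sym lex_less_def one_line_def word_perm_def upt_Suc_numeral)
  show ?thesis
  proof (rule complement_not_reverse_homomesicI
      [where v = "[1, 3, 2]" and w = "[2, 1, 3]" and n = 3
        and c = "\<lambda>n. int (card (Sym n) + 1)"], goal_cases)
    case (1 n \<sigma>)
    then show ?case using lex_rank_complement[of \<sigma> n] by linarith
  qed (use 1 2 in simp_all)
qed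

lemma homomesy_first_entry:
  "complement_not_reverse_homomesic (\<lambda>n \<sigma>. int (\<sigma> 1))"
proof (rule complement_not_reverse_homomesicI
    [where v = "[1, 2, 3]" and w = "[1, 3, 2]" and n = 3
      and c = "\<lambda>n. int (n + 1)"], goal_cases)
  case (1 n \<sigma>)
  then show ?case using complement_entry_add[of \<sigma> n 1] by simp
qed (simp_all add: stat_eval)

lemma homomesy_staircase_size:
  "complement_not_reverse_homomesic (\<lambda>n \<sigma>. int (staircase_size n \<sigma>))"
\<comment> \<open>12345 and 54321 have sizes 0 and 4. The words 21453 and 35412 have codes 10110 and
  23200, hence sizes 1 and 2.\<close>
proof (rule complement_not_reverse_homomesicI
    [where v = "[1, 2, 3, 4, 5]" and w = "[2, 1, 4, 5, 3]" and n = 5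
      and c = "\<lambda>n. int (n - 1)"], goal_cases)
  case (1 n \<sigma>)
  then show ?case using staircase_size_complement[of \<sigma> n] by linarith
qed (simp_all add: stat_eval)

lemma homomesy_bs_stat:
  "complement_not_reverse_homomesic (\<lambda>n \<sigma>. int (bs_stat n \<sigma>))"
\<comment> \<open>On S_3 every reversal sum is 3, hence size 4; here the sums are 6 and 5.\<close>
proof (rule complement_not_reverse_homomesicI
    [where v = "[1, 2, 3, 4]" and w = "[1, 2, 4, 3]" and n = 4
      and c = "\<lambda>n. int (card {(i, k). 1 \<le> i \<and> i + 1 < k \<and> k \<le> n} + (n - 1))"], goal_cases)
  case (1 n \<sigma>)
  then show ?case using bs_stat_complement[of \<sigma> n] by linarith
qed (simp_all add: stat_eval)

lemma homomesy_last_entry: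
  "complement_not_reverse_homomesic (\<lambda>n \<sigma>. int (\<sigma> n))"
proof (rule complement_not_reverse_homomesicI
    [where v = "[1, 2, 3]" and w = "[1, 3, 2]" and n = 3
      and c = "\<lambda>n. int (n + 1)"], goal_cases)
  case (1 n \<sigma>)
  then show ?case using complement_entry_add[of \<sigma> n n] by simp
qed (simp_all add: stat_eval)

lemma homomesy_nonneg_steps:
  "complement_not_reverse_homomesic (\<lambda>n \<sigma>. int (nonneg_steps n \<sigma>))"
\<comment> \<open>The walks of 132 and 231 both go up and then down, giving sum 4; those of 123 and
  321 give 2 + 0.\<close>
proof (rule complement_not_reverse_homomesicI
    [where v = "[1, 2, 3]" and w = "[1, 3, 2]" and n = 3
      and c = "\<lambda>n. int (n - 1)"], goal_cases)
  case (1 n \<sigma>)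
  then show ?case using nonneg_steps_complement[of \<sigma> n] by linarith
qed (simp_all add: stat_eval)

lemma homomesy_maj_minus_inversions:
  "complement_not_reverse_homomesic (\<lambda>n \<sigma>. int (maj n \<sigma>) - int (inversions n \<sigma>))"
\<comment> \<open>Inversions of a word and its reversal always total 3 here, so the failure for
  \<open>maj\<close> carries over.\<close>
proof (rule complement_not_reverse_homomesicI
    [where v = "[1, 2, 3]" and w = "[1, 3, 2]" and n = 3
      and c = "\<lambda>n. int (\<Sum>{1..<n}) - int (card {(i, j). 1 \<le> i \<and> i < j \<and> j \<le> n})"], goal_cases)
  case (1 n \<sigma>)
  then show ?case using maj_complement[of \<sigma> n] inversions_complement[of \<sigma> n] by linarith
qed (simp_all add: stat_eval)

lemma homomesy_inversions_plus_maj: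
  "complement_not_reverse_homomesic (\<lambda>n \<sigma>. int (inversions n \<sigma>) + int (maj n \<sigma>))"
proof (rule complement_not_reverse_homomesicI
    [where v = "[1, 2, 3]" and w = "[1, 3, 2]" and n = 3
      and c = "\<lambda>n. int (card {(i, j). 1 \<le> i \<and> i < j \<and> j \<le> n}) + int (\<Sum>{1..<n})"], goal_cases)
  case (1 n \<sigma>)
  then show ?case using maj_complement[of \<sigma> n] inversions_complement[of \<sigma> n] by linarith
qed (simp_all add: stat_eval)

theorem theorem5p5:
  fixes st :: "nat \<Rightarrow> (nat \<Rightarrow> nat) \<Rightarrow> int"
  assumes "st \<in>
    {(\<lambda>n \<sigma>. int (lehmer n \<sigma> 2)),
     (\<lambda>n \<sigma>. int (lehmer n \<sigma> 3)),
     (\<lambda>n \<sigma>. int (maj n \<sigma>)),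
     (\<lambda>n \<sigma>. int (odd_descents n \<sigma>)),
     (\<lambda>n \<sigma>. int (even_descents n \<sigma>)),
     (\<lambda>n \<sigma>. int (lex_rank n \<sigma>)),
     (\<lambda>n \<sigma>. int (\<sigma> 1)),
     (\<lambda>n \<sigma>. int (staircase_size n \<sigma>)),
     (\<lambda>n \<sigma>. int (bs_stat n \<sigma>)),
     (\<lambda>n \<sigma>. int (\<sigma> n)),
     (\<lambda>n \<sigma>. int (nonneg_steps n \<sigma>)),
     (\<lambda>n \<sigma>. int (maj n \<sigma>) - int (inversions n \<sigma>)),
     (\<lambda>n \<sigma>. int (inversions n \<sigma>) + int (maj n \<sigma>))}"
  shows "(\<forall>n\<ge>1. homomesic (Sym n) (complement_perm n) (st n)) \<and>
         (\<exists>n\<ge>1. \<not> homomesic (Sym n) (reverse_perm n) (st n))"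
proof -
  have "complement_not_reverse_homomesic st"
    using assms
    by (elim insertE emptyE)
      (simp_all only: homomesy_lehmer_2 homomesy_lehmer_3 homomesy_maj homomesy_odd_descents
        homomesy_even_descents homomesy_lex_rank homomesy_first_entry homomesy_staircase_size
        homomesy_bs_stat homomesy_last_entry homomesy_nonneg_steps
        homomesy_maj_minus_inversions homomesy_inversions_plus_maj)
  then show ?thesis unfolding complement_not_reverse_homomesic_def .
qed

end
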